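(* Let $w\in\mathbb{R}^n$ and $f(x)=wx$. Then $f$ is $n(4nN)^n$-reducible; that is, for every $N\in\mathbb{N}$ there exists a linear function $g$, integer-valued on $[-N,N]^n\cap\mathbb{Z}^n$, such that $g$ is equivalent to $f$ on $[-N,N]^n$ and $$g_{\max}^{[-N,N]^n}\le n(4nN)^n.$$
   Context: $wx$ denotes the scalar product, $\mathbb{N}$ the positive integers, and $[-N,N]^n$ the set of integer points $\{x\in\mathbb{Z}^n : -N\le x_i\le N\ \forall i\}$. Two functions $f,g$ are equivalent on $D\subseteq\mathbb{Z}^n$ if for all $x,y\in D$: $f(x)\ge f(y)\Leftrightarrow g(x)\ge g(y)$. For a box $D$, $g_{\max}^{D}:=\max_{x,x'\in D}|g(x)-g(x')|$. For $\rho:\mathbb{N}\to\mathbb{N}$, a linear function $f:\mathbb{R}^n\to\mathbb{R}$ is $\rho$-reducible if for every $N\in\mathbb{N}$ there is a linear function $g:[-N,N]^n\to\mathbb{Z}$ which is equivalent to $f$ on $[-N,N]^n$ and satisfies $g_{\max}^{[-N,N]^n}\le\rho(N)$. *)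

theory Defs
  imports "HOL-Analysis.Analysis"
begin

text \<open>
  Integer points are represented as vectors in \<open>real ^ 'n\<close> with integral coordinates, so that
  linear functions on the real space can be evaluated at them directly.
\<close>

definition int_box :: "nat \<Rightarrow> (real ^ 'n) set" where
  "int_box N = {x. \<forall>i. x $ i \<in> \<int> \<and> - real N \<le> x $ i \<and> x $ i \<le> real N}"

definition equivalent_on :: "'a set \<Rightarrow> ('a \<Rightarrow> real) \<Rightarrow> ('a \<Rightarrow> real) \<Rightarrow> bool" where
  "equivalent_on D f g \<longleftrightarrow> (\<forall>x\<in>D. \<forall>y\<in>D. f x \<ge> f y \<longleftrightarrow> g x \<ge> g y)"

text \<open>
  The maximum below is meaningful only for finite nonempty \<open>D\<close>; for \<open>D = int_box N\<close> this is
  guaranteed by \<open>finite_int_box\<close> and \<open>int_box_nonempty\<close>.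
\<close>

definition max_diff :: "'a set \<Rightarrow> ('a \<Rightarrow> real) \<Rightarrow> real" where
  "max_diff D g = Max {\<bar>g x - g x'\<bar> | x x'. x \<in> D \<and> x' \<in> D}"

text \<open>
  A function \<open>g\<close> on the integer box with integer values that is linear is the restriction of a
  linear map on \<open>real ^ 'n\<close> that is integral on the box. The index \<open>N\<close> ranges over the positive
  integers only.
\<close>

definition reducible :: "(nat \<Rightarrow> nat) \<Rightarrow> (real ^ 'n \<Rightarrow> real) \<Rightarrow> bool" where
  "reducible \<rho> f \<longleftrightarrow> linear f \<and>
     (\<forall>N>0. \<exists>g :: real ^ 'n \<Rightarrow> real.
        linear g \<and> g ` int_box N \<subseteq> \<int> \<and>
        equivalent_on (int_box N) f g \<and>
        max_diff (int_box N) g \<le> real (\<rho> N))"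

lemma finite_int_box: "finite (int_box N :: (real ^ 'n) set)"
proof -
  let ?S = "{y :: real. y \<in> \<int> \<and> - real N \<le> y \<and> y \<le> real N}"
  have "?S \<subseteq> of_int ` {- int N .. int N}"
    by (force elim!: Ints_cases)
  then have "finite ?S"
    by (rule finite_subset) simp
  then have "finite {f :: 'n \<Rightarrow> real. \<forall>i. (i \<in> UNIV \<longrightarrow> f i \<in> ?S) \<and> (i \<notin> UNIV \<longrightarrow> f i = 0)}"
    by (intro finite_set_of_finite_funs) simp_all
  then have "finite (vec_lambda ` {f :: 'n \<Rightarrow> real. \<forall>i. f i \<in> ?S})"
    by simp
  moreover have "int_box N \<subseteq> vec_lambda ` {f :: 'n \<Rightarrow> real. \<forall>i. f i \<in> ?S}"
    by (auto simp: int_box_def image_iff intro!: exI[where x = "vec_nth _"])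
  ultimately show ?thesis
    by (rule finite_subset[rotated])
qed

lemma int_box_nonempty: "int_box N \<noteq> {}"
proof -
  have "0 \<in> int_box N"
    by (simp add: int_box_def)
  then show ?thesis
    by blast
qed

end

theory Submission
  imports Defs
begin

text \<open>
  The differences of two points of the box are the integer points of the box of radius \<open>2 * N\<close>,
  so \<open>g(x) = u x\<close> is equivalent to \<open>f\<close> as soon as \<open>u z\<close> and \<open>w z\<close> have the same sign for all
  those points \<open>z\<close>. Up to positive scaling, the vectors \<open>u\<close> with this property are the points of
  the polyhedron given by \<open>u z \<ge> 1\<close> when \<open>w z > 0\<close> and \<open>u z \<ge> 0\<close> when \<open>w z = 0\<close>. It contains a
  multiple of \<open>w\<close>, and its constraints span the space, so it has a vertex. By Cramer's rule,
  multiplying the vertex by the determinant of \<open>n\<close> independent tight constraints gives an integer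
  vector whose coordinates are determinants with one column of entries in \<open>{0, 1}\<close> and all other
  entries bounded by \<open>2 * N\<close>.
\<close>

text \<open>Take a feasible point with as many tight constraints as possible. If these did not span
  the space, one could move orthogonally to them until a further constraint becomes tight,
  contradicting maximality.\<close>

lemma polyhedron_vertex_exists:
  fixes C :: "'a::euclidean_space set"
  assumes "finite C" and span: "span C = UNIV" and feasible: "\<forall>z\<in>C. b z \<le> u0 \<bullet> z"
  obtains u where "\<forall>z\<in>C. b z \<le> u \<bullet> z" "span {z\<in>C. u \<bullet> z = b z} = UNIV"
proof -
  define P where "P u \<longleftrightarrow> (\<forall>z\<in>C. b z \<le> u \<bullet> z)" for u
  define T where "T u = {z\<in>C. u \<bullet> z = b z}" for u
  have fin_T: "finite (T u)" for u
    using \<open>finite C\<close> by (simp add: T_def)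
  have "card (T u) < Suc (card C)" for u
    using \<open>finite C\<close> by (auto simp: T_def less_Suc_eq_le intro: card_mono)
  then obtain u where Pu: "P u" and max: "\<And>v. P v \<Longrightarrow> card (T v) \<le> card (T u)"
    using ex_has_greatest_nat[of P u0 "\<lambda>u. card (T u)" "Suc (card C)"] feasible
    by (auto simp: P_def)
  have "span (T u) = UNIV"
  proof (rule ccontr)
    assume "span (T u) \<noteq> UNIV"
    then obtain d0 where "d0 \<noteq> 0" and d0: "\<forall>z\<in>span (T u). d0 \<bullet> z = 0"
      using span_not_UNIV_orthogonal by blast
    have "\<exists>z\<in>C. d0 \<bullet> z \<noteq> 0"
    proof (rule ccontr)
      assume "\<not> ?thesis"
      then have "orthogonal d0 d0"
        by (intro orthogonal_to_span[of d0 C]) (auto simp: span orthogonal_def)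
      with \<open>d0 \<noteq> 0\<close> show False
        by (simp add: orthogonal_self)
    qed
    then obtain z1 where "z1 \<in> C" "d0 \<bullet> z1 \<noteq> 0"
      by blast
    \<comment> \<open>The sign is chosen so that moving along \<open>d\<close> shrinks the slack of
      \<open>z1\<close>; hence the motion must hit some constraint.\<close>
    define d where "d = (if d0 \<bullet> z1 < 0 then d0 else - d0)"
    have d_z1: "d \<bullet> z1 < 0" and d_T: "\<And>z. z \<in> T u \<Longrightarrow> d \<bullet> z = 0"
      using \<open>d0 \<bullet> z1 \<noteq> 0\<close> d0 by (auto simp: d_def span_base)
    define S where "S = {z\<in>C. d \<bullet> z < 0}"
    \<comment> \<open>Ratio test: \<open>r z\<close> is the step length along \<open>d\<close> at
      which the constraint of \<open>z\<close> becomes tight, so the least such step stays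
      feasible.\<close>
    define r where "r z = (u \<bullet> z - b z) / - (d \<bullet> z)" for z
    have "finite S" "S \<noteq> {}"
      using \<open>finite C\<close> \<open>z1 \<in> C\<close> d_z1 by (auto simp: S_def)
    then obtain z0 where "z0 \<in> S" and min: "\<And>z. z \<in> S \<Longrightarrow> r z0 \<le> r z"
      using ex_is_arg_min_if_finite[of S r] by (force simp: is_arg_min_linorder)
    define v where "v = u + r z0 *\<^sub>R d"
    have "r z0 \<ge> 0"
      using \<open>z0 \<in> S\<close> Pu by (auto simp: S_def P_def r_def intro!: divide_nonneg_neg)
    have "P v"
      unfolding P_def
    proof
      fix z assume "z \<in> C"
      show "b z \<le> v \<bullet> z"
      proof (cases "d \<bullet> z < 0")
        case True
        then have "r z0 * - (d \<bullet> z) \<le> u \<bullet> z - b z"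
          using min[of z] \<open>z \<in> C\<close> by (simp only: S_def r_def pos_le_divide_eq neg_0_less_iff_less) simp
        then show ?thesis
          by (simp add: v_def inner_add_left)
      next
        case False
        then show ?thesis
          using \<open>r z0 \<ge> 0\<close> Pu \<open>z \<in> C\<close> by (simp add: P_def v_def inner_add_left add_increasing2)
      qed
    qed
    have "z0 \<in> T v" "z0 \<notin> T u"
      using \<open>z0 \<in> S\<close> d_T[of z0] by (auto simp: S_def T_def v_def r_def inner_add_left inner_diff_left)
    moreover have "T u \<subseteq> T v"
      using d_T by (auto simp: T_def v_def inner_add_left)
    ultimately have "card (T u) < card (T v)"
      by (intro psubset_card_mono fin_T) auto
    with max[OF \<open>P v\<close>] show False
      by simp
  qed
  with Pu show thesis
    by (intro that[of u]) (auto simp: P_def T_def)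
qed

text \<open>Each term of the Leibniz formula takes exactly one entry from every column. Bounds that
  depend on the column let a 0/1 column in Cramer's rule count with factor 1.\<close>

lemma abs_det_le:
  fixes A :: "real ^ 'n ^ 'n"
  assumes "\<And>i j. \<bar>A $ i $ j\<bar> \<le> c j"
  shows "\<bar>det A\<bar> \<le> fact CARD('n) * (\<Prod>j\<in>UNIV. c j)"
proof -
  let ?S = "{p :: 'n \<Rightarrow> 'n. p permutes UNIV}"
  have "\<bar>det A\<bar> \<le> (\<Sum>p\<in>?S. \<bar>of_int (sign p) * (\<Prod>i\<in>UNIV. A $ i $ p i)\<bar>)"
    unfolding det_def by (rule sum_abs)
  also have "\<dots> \<le> (\<Sum>p\<in>?S. \<Prod>j\<in>UNIV. c j)"
  proof (rule sum_mono)
    fix p :: "'n \<Rightarrow> 'n" assume "p \<in> ?S"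
    then have p: "p permutes UNIV"
      by simp
    have "\<bar>of_int (sign p) * (\<Prod>i\<in>UNIV. A $ i $ p i)\<bar> = (\<Prod>i\<in>UNIV. \<bar>A $ i $ p i\<bar>)"
      by (simp add: abs_mult abs_prod sign_def)
    also have "\<dots> \<le> (\<Prod>i\<in>UNIV. c (p i))"
      by (intro prod_mono) (simp add: assms)
    also have "\<dots> = (\<Prod>j\<in>UNIV. c j)"
      using prod.permute[OF p, of c] by (simp add: o_def)
    finally show "\<bar>of_int (sign p) * (\<Prod>i\<in>UNIV. A $ i $ p i)\<bar> \<le> (\<Prod>j\<in>UNIV. c j)" .
  qed
  also have "\<dots> = fact CARD('n) * (\<Prod>j\<in>UNIV. c j)"
    by (simp add: card_permutations)
  finally show ?thesis .
qed

lemma det_in_Ints: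
  fixes A :: "real ^ 'n ^ 'n"
  assumes "\<And>i j. A $ i $ j \<in> \<int>"
  shows "det A \<in> \<int>"
  unfolding det_def by (intro Ints_sum Ints_mult Ints_prod assms) auto

text \<open>A basis of the space chosen inside \<open>T\<close>, indexed by \<open>'n\<close>,
  supplies the rows. This turns the tight constraints at a vertex into a square system for Cramer's
  rule.\<close>

lemma spanning_rows_exist:
  fixes T :: "(real ^ 'n) set"
  assumes "span T = UNIV"
  obtains A :: "real ^ 'n ^ 'n" where "\<And>i. A $ i \<in> T" "det A \<noteq> 0"
proof -
  obtain B where B: "B \<subseteq> T" "independent B" "T \<subseteq> span B" "card B = dim T"
    using basis_exists[of T] by blast
  have "dim T = CARD('n)"
    using dim_span[of T] by (simp add: assms)
  then have "finite B" "card B = CARD('n)"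
    using B by (auto intro: finiteI_independent)
  then obtain h :: "'n \<Rightarrow> real ^ 'n" where "bij_betw h UNIV B"
    using finite_same_card_bij[of "UNIV :: 'n set" B] by auto
  then have range: "range h = B"
    by (simp add: bij_betw_def)
  define A :: "real ^ 'n ^ 'n" where "A = (\<chi> i. h i)"
  have "rows A = B"
    by (auto simp: rows_def row_def A_def range[symmetric])
  moreover have "span B = UNIV"
    using B(3) assms span_minimal[of T "span B"] by (auto simp: subspace_span)
  ultimately have "invertible A"
    by (simp add: invertible_left_inverse matrix_left_invertible_span_rows)
  moreover have "A $ i \<in> T" for i
    using range B(1) by (auto simp: A_def)
  ultimately show thesis
    by (intro that[of A]) (auto simp: invertible_det_nz)
qed

lemma bounded_integer_direction:
  fixes w :: "real ^ 'n"
  assumes "M > 0"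
  obtains u :: "real ^ 'n"
  where "\<And>i. u $ i \<in> \<int>" "\<And>i. \<bar>u $ i\<bar> \<le> fact CARD('n) * real M ^ (CARD('n) - 1)"
    "\<And>z. z \<in> int_box M \<Longrightarrow> u \<bullet> z \<ge> 0 \<longleftrightarrow> w \<bullet> z \<ge> 0"
proof -
  define C where "C = {z \<in> int_box M. w \<bullet> z \<ge> 0}"
  \<comment> \<open>Asking for at least 1 in place of a strict inequality makes the constraints
    closed, and right-hand sides 0 and 1 keep the Cramer numerators small.\<close>
  define b :: "real ^ 'n \<Rightarrow> real" where "b z = (if w \<bullet> z = 0 then 0 else 1)" for z
  have "finite C"
    by (simp add: C_def finite_int_box)
  have uminus_box: "- z \<in> int_box M" if "z \<in> int_box M" for z :: "real ^ 'n"
    using that by (auto simp: int_box_def minus_le_iff)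
  have "span C = UNIV"
  proof -
    have "e \<in> span C" if "e \<in> Basis" for e
    proof -
      have "e \<in> int_box M"
        using that assms by (auto simp: Basis_vec_def int_box_def axis_def)
      \<comment> \<open>The box is symmetric, and \<open>w\<close> is nonnegative on one of
        \<open>e\<close> and \<open>- e\<close>.\<close>
      then have "e \<in> C \<or> - e \<in> C"
        using uminus_box by (auto simp: C_def)
      then show ?thesis
        using span_base[of e C] span_neg[OF span_base[of "- e" C]] by auto
    qed
    then show ?thesis
      using span_minimal[of Basis "span C"] by (auto simp: subspace_span)
  qed
  \<comment> \<open>Dividing \<open>w\<close> by its least positive value on \<open>C\<close> gives
    a feasible point; the inserted 1 covers the case without positive values, such as
    \<open>w = 0\<close>.\<close>
  define m where "m = Min (insert 1 ((\<lambda>z. w \<bullet> z) ` {z\<in>C. w \<bullet> z > 0}))"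
  have "m > 0" and m_le: "\<And>z. z \<in> C \<Longrightarrow> w \<bullet> z > 0 \<Longrightarrow> m \<le> w \<bullet> z"
    using \<open>finite C\<close> by (auto simp: m_def)
  have "\<forall>z\<in>C. b z \<le> (w /\<^sub>R m) \<bullet> z"
  proof
    fix z assume "z \<in> C"
    then have "w \<bullet> z = 0 \<or> m \<le> w \<bullet> z"
      using m_le[of z] by (force simp: C_def)
    then show "b z \<le> (w /\<^sub>R m) \<bullet> z"
      using \<open>m > 0\<close> by (auto simp: b_def field_simps)
  qed
  from polyhedron_vertex_exists[OF \<open>finite C\<close> \<open>span C = UNIV\<close> this]
  obtain v where v: "\<forall>z\<in>C. b z \<le> v \<bullet> z" and "span {z\<in>C. v \<bullet> z = b z} = UNIV" .
  then obtain A :: "real ^ 'n ^ 'n"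
    where A: "\<And>i. A $ i \<in> {z\<in>C. v \<bullet> z = b z}" and "det A \<noteq> 0"
    using spanning_rows_exist by metis
  \<comment> \<open>The numerator matrix of Cramer's rule: column \<open>k\<close> is replaced by
    the right-hand side.\<close>
  define R where "R k = (\<chi> i j. if j = k then b (A $ i) else A $ i $ j)" for k
  have "A *v v = (\<chi> i. b (A $ i))"
    using A by (simp add: vec_eq_iff matrix_vector_mul_component inner_commute)
  then have v_eq: "v $ k = det (R k) / det A" for k
    using cramer[OF \<open>det A \<noteq> 0\<close>, of v "\<chi> i. b (A $ i)"] by (simp add: R_def cong: if_cong)
  \<comment> \<open>The absolute value clears denominators without changing the sign of any
    \<open>v \<bullet> z\<close>.\<close>
  define u where "u = \<bar>det A\<bar> *\<^sub>R v"
  have u_eq: "u $ k = sgn (det A) * det (R k)" for k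
    using \<open>det A \<noteq> 0\<close> by (simp add: u_def v_eq sgn_if)
  have A_box: "A $ i $ j \<in> \<int>" "\<bar>A $ i $ j\<bar> \<le> real M" for i j
    using A[of i] by (auto simp: C_def int_box_def abs_le_iff minus_le_iff)
  show thesis
  proof
    have "det (R k) \<in> \<int>" for k
      by (rule det_in_Ints) (simp add: R_def b_def A_box)
    then show "u $ k \<in> \<int>" for k
      by (simp add: u_eq sgn_if)
    fix k
    have "\<bar>u $ k\<bar> = \<bar>det (R k)\<bar>"
      using \<open>det A \<noteq> 0\<close> by (simp add: u_eq abs_mult)
    also have "\<dots> \<le> fact CARD('n) * (\<Prod>j\<in>UNIV. if j = k then 1 else real M)"
      by (rule abs_det_le) (simp add: R_def b_def A_box)
    also have "(\<Prod>j\<in>UNIV. if j = k then 1 else real M) = real M ^ (CARD('n) - 1)"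
      by (subst prod.remove[of UNIV k]) (simp_all add: card_Diff_singleton)
    finally show "\<bar>u $ k\<bar> \<le> fact CARD('n) * real M ^ (CARD('n) - 1)" .
  next
    fix z :: "real ^ 'n" assume z: "z \<in> int_box M"
    have "v \<bullet> z \<ge> 0 \<longleftrightarrow> w \<bullet> z \<ge> 0"
    proof
      assume "w \<bullet> z \<ge> 0"
      then show "v \<bullet> z \<ge> 0"
        using v z by (force simp: C_def b_def split: if_splits)
    next
      assume "v \<bullet> z \<ge> 0"
      show "w \<bullet> z \<ge> 0"
      proof (rule ccontr)
        assume "\<not> w \<bullet> z \<ge> 0"
        \<comment> \<open>Here \<open>- z\<close> lies in \<open>C\<close> with a positive value of
          \<open>w\<close>, so its constraint forces \<open>v \<bullet> z \<le> -1\<close>.\<close>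
        then have "b (- z) \<le> v \<bullet> (- z)" "b (- z) = 1"
          using v uminus_box[OF z] by (auto simp: C_def b_def)
        with \<open>v \<bullet> z \<ge> 0\<close> show False
          by simp
      qed
    qed
    then show "u \<bullet> z \<ge> 0 \<longleftrightarrow> w \<bullet> z \<ge> 0"
      using \<open>det A \<noteq> 0\<close> by (simp add: u_def zero_le_mult_iff)
  qed
qed

theorem theorem68:
  fixes w :: "real ^ 'n"
  shows "reducible (\<lambda>N. CARD('n) * (4 * CARD('n) * N) ^ CARD('n)) (\<lambda>x. w \<bullet> x)"
  unfolding reducible_def
proof (intro conjI allI impI)
  show "linear (\<lambda>x. w \<bullet> x)"
    by (rule bounded_linear.linear[OF bounded_linear_inner_right])
  fix N :: nat assume "N > 0"
  let ?n = "CARD('n)"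
  let ?c = "fact ?n * real (2 * N) ^ (?n - 1)"
  have "2 * N > 0"
    using \<open>N > 0\<close> by simp
  then obtain u :: "real ^ 'n" where u_int: "\<And>i. u $ i \<in> \<int>" and u_le: "\<And>i. \<bar>u $ i\<bar> \<le> ?c"
    and u_sign: "\<And>z. z \<in> int_box (2 * N) \<Longrightarrow> u \<bullet> z \<ge> 0 \<longleftrightarrow> w \<bullet> z \<ge> 0"
    using bounded_integer_direction[of "2 * N" w] by blast
  have diff_box: "x - y \<in> int_box (2 * N)" if "x \<in> int_box N" "y \<in> int_box N" for x y :: "real ^ 'n"
    unfolding int_box_def
  proof (intro CollectI allI)
    fix i
    show "(x - y) $ i \<in> \<int> \<and> - real (2 * N) \<le> (x - y) $ i \<and> (x - y) $ i \<le> real (2 * N)"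
      using that unfolding int_box_def by (auto dest!: spec[of _ i])
  qed
  have diff_le: "\<bar>u \<bullet> x - u \<bullet> y\<bar> \<le> real (?n * (4 * ?n * N) ^ ?n)"
    if "x \<in> int_box N" "y \<in> int_box N" for x y
  proof -
    have "\<bar>u \<bullet> x - u \<bullet> y\<bar> = \<bar>\<Sum>i\<in>UNIV. u $ i * (x - y) $ i\<bar>"
      by (simp only: inner_diff_right[symmetric]) (simp add: inner_vec_def)
    also have "\<dots> \<le> (\<Sum>i\<in>UNIV. \<bar>u $ i\<bar> * \<bar>(x - y) $ i\<bar>)"
      using sum_abs by (simp add: abs_mult[symmetric])
    also have "\<dots> \<le> (\<Sum>i\<in>(UNIV :: 'n set). ?c * real (2 * N))"
      using diff_box[OF that] u_le
      by (intro sum_mono mult_mono) (auto simp: int_box_def abs_le_iff minus_le_iff)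
    \<comment> \<open>The factor \<open>2 * N\<close> from the coordinates of \<open>x - y\<close>
      raises the exponent from \<open>?n - 1\<close> to \<open>?n\<close>.\<close>
    also have "\<dots> = real ?n * (fact ?n * real (2 * N) ^ ?n)"
      using power_minus_mult[of ?n "real (2 * N)"] by (simp add: mult.assoc)
    \<comment> \<open>The stated bound follows from \<open>fact ?n \<le> ?n ^ ?n\<close> and
      \<open>2 * N \<le> 4 * N\<close>.\<close>
    also have "\<dots> \<le> real ?n * (real ?n ^ ?n * real (4 * N) ^ ?n)"
      using fact_le_power[of ?n, where 'a = real]
      by (intro mult_left_mono mult_mono power_mono) auto
    also have "\<dots> = real (?n * (4 * ?n * N) ^ ?n)"
      by (simp add: power_mult_distrib)
    finally show ?thesis .
  qed
  show "\<exists>g :: real ^ 'n \<Rightarrow> real. linear g \<and> g ` int_box N \<subseteq> \<int> \<and>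
      equivalent_on (int_box N) (\<lambda>x. w \<bullet> x) g \<and>
      max_diff (int_box N) g \<le> real (?n * (4 * ?n * N) ^ ?n)"
  proof (intro exI[of _ "\<lambda>x. u \<bullet> x"] conjI)
    show "linear (\<lambda>x. u \<bullet> x)"
      by (rule bounded_linear.linear[OF bounded_linear_inner_right])
    show "(\<lambda>x. u \<bullet> x) ` int_box N \<subseteq> \<int>"
      using u_int by (auto simp: inner_vec_def int_box_def intro!: Ints_sum Ints_mult)
    \<comment> \<open>Comparing values at \<open>x\<close> and \<open>y\<close> amounts to the sign
      at \<open>x - y\<close>, where \<open>u\<close> and \<open>w\<close> agree.\<close>
    show "equivalent_on (int_box N) (\<lambda>x. w \<bullet> x) (\<lambda>x. u \<bullet> x)"
      using u_sign diff_box by (force simp: equivalent_on_def inner_diff_right)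
    let ?D = "{\<bar>u \<bullet> x - u \<bullet> x'\<bar> | x x'. x \<in> int_box N \<and> x' \<in> int_box N}"
    have D_eq: "?D = (\<lambda>(x, x'). \<bar>u \<bullet> x - u \<bullet> x'\<bar>) ` (int_box N \<times> int_box N)"
      by auto
    have "finite ?D" "?D \<noteq> {}"
      unfolding D_eq by (simp_all add: finite_int_box int_box_nonempty)
    then show "max_diff (int_box N) (\<lambda>x. u \<bullet> x) \<le> real (?n * (4 * ?n * N) ^ ?n)"
      unfolding max_diff_def using diff_le by (subst Max_le_iff) auto
  qed
qed

end
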